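(* Let $q$ be a prime power and let $k,\ell,\mu\ge 1$ be integers. Consider the $(q,k,\ell,\mu)$-PRNG identification procedure, and assume that the pseudo-random number generator (PRNG), started in the randomly chosen state $\sigma$, generates a sequence of sufficient length (at least $k\ell$) of independent random variables uniformly distributed on $\mathbb{F}_q$, so that the $k\times\ell$ matrix $G(\sigma)$ has independent entries uniformly distributed on $\mathbb{F}_q$. Let a decoder expecting the message $u'\in\mathbb{F}_q^k$ receive the identification word $w=(\sigma,\tau)$ corresponding to the message $u\in\mathbb{F}_q^k$. Then for any $u\ne u'$ the probability of false acceptance is $$P_2(u,u')=q^{-\ell},$$ i.e. $\lambda_2=q^{-\ell}$.
   Context: A PRNG with memory $\mu$ over the finite field $\mathbb{F}_q$ is a finite state machine with $\mu$ $q$-ary memory elements: from an initial state (seed) $\sigma\in\mathbb{F}_q^\mu$ it produces a sequence $s=(s_1,s_2,\dots)$ of elements of $\mathbb{F}_q$ of any required length. The $(q,k,\ell,\mu)$-PRNG identification procedure (noiseless channel): messages are the vectors $u\in\mathbb{F}_q^k$ (row vectors). To send $u$, the encoder chooses a random initial state $\sigma\in\mathbb{F}_q^\mu$ and uses the PRNG to generate one after another $\ell$ column vectors $g^{(1)},\dots,g^{(\ell)}\in\mathbb{F}_q^k$ (consecutive segments of length $k$ of the generated sequence), forming the $k\times\ell$ matrix $G(\sigma)=(g^{(1)},\dots,g^{(\ell)})$. It computes the tag vector $\tau=uG(\sigma)\in\mathbb{F}_q^\ell$ and transmits the identification word $w=(\sigma,\tau)$. A decoder expecting the message $u'$ receives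 $w$, computes $G(\sigma)$ and $\tau'=u'G(\sigma)$, and accepts the message if and only if $\tau'=\tau$. For $u\neq u'$, $P_2(u,u')$ denotes the probability of false acceptance, i.e. the probability, over the random choice of $\sigma$, that $u'G(\sigma)=uG(\sigma)$. The false acceptance probability of the procedure is $\lambda_2=\max_{u\ne u'}P_2(u,u')$. *)

theory Defs
  imports
    "HOL-Probability.Probability"
    "HOL-Number_Theory.Prime_Powers"
    "Jordan_Normal_Form.Matrix"
begin

(* Both HOL-Analysis and Jordan_Normal_Form provide names such as vec and mat;
   the qualified names below refer to the latter, where dimensions are natural numbers. *)

record 'a prng =
  next_state :: "'a Matrix.vec \<Rightarrow> 'a Matrix.vec"
  output_elem :: "'a Matrix.vec \<Rightarrow> 'a"

definition prng_with_memory :: "nat \<Rightarrow> 'a prng \<Rightarrow> bool" where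
  "prng_with_memory \<mu> R \<longleftrightarrow> (\<forall>\<sigma>\<in>carrier_vec \<mu>. next_state R \<sigma> \<in> carrier_vec \<mu>)"

(* The sequence is indexed from 0: prng_seq R \<sigma> i is the (i+1)-st generated element. *)
definition prng_seq :: "'a prng \<Rightarrow> 'a Matrix.vec \<Rightarrow> nat \<Rightarrow> 'a" where
  "prng_seq R \<sigma> i = output_elem R ((next_state R ^^ i) \<sigma>)"

(* Column j is the j-th consecutive segment of length k of the generated sequence. *)
definition gen_matrix :: "'a prng \<Rightarrow> nat \<Rightarrow> nat \<Rightarrow> 'a Matrix.vec \<Rightarrow> 'a Matrix.mat" where
  "gen_matrix R k l \<sigma> = Matrix.mat k l (\<lambda>(i, j). prng_seq R \<sigma> (j * k + i))"

definition tag_vec ::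
  "'a::comm_semiring_0 prng \<Rightarrow> nat \<Rightarrow> nat \<Rightarrow> 'a Matrix.vec \<Rightarrow> 'a Matrix.vec \<Rightarrow> 'a Matrix.vec" where
  "tag_vec R k l \<sigma> u = Matrix.row (mat_of_row u * gen_matrix R k l \<sigma>) 0"

definition id_word ::
  "'a::comm_semiring_0 prng \<Rightarrow> nat \<Rightarrow> nat \<Rightarrow> 'a Matrix.vec \<Rightarrow> 'a Matrix.vec
     \<Rightarrow> 'a Matrix.vec \<times> 'a Matrix.vec" where
  "id_word R k l \<sigma> u = (\<sigma>, tag_vec R k l \<sigma> u)"

definition accepts ::
  "'a::comm_semiring_0 prng \<Rightarrow> nat \<Rightarrow> nat \<Rightarrow> 'a Matrix.vec
     \<Rightarrow> 'a Matrix.vec \<times> 'a Matrix.vec \<Rightarrow> bool" where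
  "accepts R k l u' w \<longleftrightarrow> (case w of (\<sigma>, \<tau>) \<Rightarrow> tag_vec R k l \<sigma> u' = \<tau>)"

(* D is the distribution from which the encoder draws the seed. *)
definition P2 ::
  "'a::comm_semiring_0 prng \<Rightarrow> nat \<Rightarrow> nat \<Rightarrow> 'a Matrix.vec pmf
     \<Rightarrow> 'a Matrix.vec \<Rightarrow> 'a Matrix.vec \<Rightarrow> real" where
  "P2 R k l D u u' = measure_pmf.prob D {\<sigma>. accepts R k l u' (id_word R k l \<sigma> u)}"

definition lambda2 ::
  "'a::comm_semiring_0 prng \<Rightarrow> nat \<Rightarrow> nat \<Rightarrow> 'a Matrix.vec pmf \<Rightarrow> real" where
  "lambda2 R k l D =
     Max {P2 R k l D u u' | u u'. u \<in> carrier_vec k \<and> u' \<in> carrier_vec k \<and> u \<noteq> u'}"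

(* The first N generated elements, as functions of the random seed, are independent
   and uniformly distributed on the finite field (UNIV is the whole field). *)
definition iid_uniform_output ::
  "'a prng \<Rightarrow> 'a Matrix.vec pmf \<Rightarrow> nat \<Rightarrow> bool" where
  "iid_uniform_output R D N \<longleftrightarrow>
     prob_space.indep_vars (measure_pmf D) (\<lambda>_. count_space UNIV)
       (\<lambda>i \<sigma>. prng_seq R \<sigma> i) {..<N} \<and>
     (\<forall>i<N. map_pmf (\<lambda>\<sigma>. prng_seq R \<sigma> i) D = pmf_of_set UNIV)"

end

(* For fixed distinct messages with difference d, acceptance means that each of the l columns
   of the generator matrix lies in the hyperplane orthogonal to d. The matrix is uniformly
   distributed on all q^(k l) matrices, of which (q^(k-1))^l have all columns in the hyperplane. *)
theory Submission
  imports Defs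
begin

text \<open>Since \<open>d i0\<close> is nonzero, the equation can be solved for the coordinate at
  \<open>i0\<close>, and the other \<open>card A - 1\<close> coordinates are free. Forgetting the
  coordinate at \<open>i0\<close> is therefore a bijection from the hyperplane onto all functions on
  \<open>A - {i0}\<close>.\<close>

lemma card_PiE_hyperplane:
  fixes d :: "'b \<Rightarrow> 'a::{field, finite}"
  assumes "finite A" and i0: "i0 \<in> A" "d i0 \<noteq> 0"
  shows "card {g \<in> A \<rightarrow>\<^sub>E UNIV. (\<Sum>i\<in>A. d i * g i) = 0} = CARD('a) ^ (card A - 1)"
proof -
  let ?H = "{g \<in> A \<rightarrow>\<^sub>E UNIV. (\<Sum>i\<in>A. d i * g i) = 0}"
  let ?B = "A - {i0}"
  \<comment> \<open>The inverse map: it fills in at \<open>i0\<close> the only value that the linear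
    equation permits.\<close>
  define solve where "solve g = g(i0 := - (\<Sum>i\<in>?B. d i * g i) / d i0)" for g :: "'b \<Rightarrow> 'a"
  have split: "(\<Sum>i\<in>A. d i * g i) = d i0 * g i0 + (\<Sum>i\<in>?B. d i * g i)" for g :: "'b \<Rightarrow> 'a"
    using assms by (simp add: sum.remove)
  have other: "(\<Sum>i\<in>?B. d i * solve g i) = (\<Sum>i\<in>?B. d i * g i)"
    "(\<Sum>i\<in>?B. d i * restrict g ?B i) = (\<Sum>i\<in>?B. d i * g i)" for g :: "'b \<Rightarrow> 'a"
    by (auto simp: solve_def intro!: sum.cong)
  have "bij_betw (\<lambda>g. restrict g ?B) ?H (?B \<rightarrow>\<^sub>E UNIV)"
  proof (rule bij_betw_byWitness[where f' = solve])
    show "\<forall>g\<in>?H. solve (restrict g ?B) = g"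
    proof
      fix g assume g: "g \<in> ?H"
      then have "g i0 = - (\<Sum>i\<in>?B. d i * g i) / d i0"
        using split[of g] i0 by (simp add: field_simps eq_neg_iff_add_eq_0)
      then have "solve (restrict g ?B) i0 = g i0"
        unfolding solve_def other(2) by simp
      \<comment> \<open>For \<open>i\<close> outside \<open>A\<close> both sides are
        \<open>undefined\<close>, because \<open>g\<close> is extensional.\<close>
      moreover have "solve (restrict g ?B) i = g i" if "i \<noteq> i0" for i
        using that g by (auto simp: solve_def restrict_def PiE_def extensional_def)
      ultimately show "solve (restrict g ?B) = g" by fastforce
    qed
    show "\<forall>g\<in>?B \<rightarrow>\<^sub>E UNIV. restrict (solve g) ?B = g"
      by (auto simp: solve_def restrict_def PiE_def extensional_def fun_eq_iff)
    show "(\<lambda>g. restrict g ?B) ` ?H \<subseteq> ?B \<rightarrow>\<^sub>E UNIV" by auto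
    have "solve g i0 = - (\<Sum>i\<in>?B. d i * g i) / d i0" for g by (simp add: solve_def)
    then have "(\<Sum>i\<in>A. d i * solve g i) = 0" for g
      unfolding split[of "solve g"] other(1) using i0 by simp
    moreover have "solve g \<in> A \<rightarrow>\<^sub>E UNIV" if "g \<in> ?B \<rightarrow>\<^sub>E UNIV" for g
      using that i0 by (auto simp: solve_def PiE_def extensional_def)
    ultimately show "solve ` (?B \<rightarrow>\<^sub>E UNIV) \<subseteq> ?H" by blast
  qed
  then show ?thesis
    using assms by (simp add: bij_betw_same_card card_PiE)
qed

text \<open>Independence applied to singleton events; it yields the point masses of a joint
  distribution.\<close>

lemma (in prob_space) indep_vars_prob_eq:
  assumes "indep_vars (\<lambda>_. count_space UNIV) X I" "finite I"
  shows "prob {x \<in> space M. \<forall>i\<in>I. X i x = f i} = (\<Prod>i\<in>I. prob {x \<in> space M. X i x = f i})"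
\<comment> \<open>The empty family is treated apart: an intersection over it would be
  \<open>UNIV\<close> instead of \<open>space M\<close>.\<close>
proof (cases "I = {}")
  case True
  then show ?thesis by (simp add: prob_space)
next
  case False
  have "prob (\<Inter>i\<in>I. X i -` {f i} \<inter> space M) = (\<Prod>i\<in>I. prob (X i -` {f i} \<inter> space M))"
    by (rule indep_varsD[OF assms(1)]) (use False assms in auto)
  moreover have "(\<Inter>i\<in>I. X i -` {f i} \<inter> space M) = {x \<in> space M. \<forall>i\<in>I. X i x = f i}"
    using False by auto
  moreover have "X i -` {f i} \<inter> space M = {x \<in> space M. X i x = f i}" for i by auto
  ultimately show ?thesis by simp
qed

text \<open>Prescribing all columns amounts to prescribing the first \<open>k * l\<close> outputs.
  By independence and uniformity this has the same probability for every choice, namely one over the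
  number of choices. Columns are modelled as nested extensional functions, so that conditions on
  separate columns become product sets whose cardinality \<open>card_PiE\<close> gives.\<close>

lemma column_segments_uniform:
  fixes R :: "'a::{field, finite} prng"
  assumes iid: "iid_uniform_output R D N" and "N \<ge> k * l" and "k \<ge> 1"
  shows "map_pmf (\<lambda>\<sigma>. \<lambda>j\<in>{..<l}. \<lambda>i\<in>{..<k}. prng_seq R \<sigma> (j * k + i)) D
    = pmf_of_set ({..<l} \<rightarrow>\<^sub>E ({..<k} \<rightarrow>\<^sub>E UNIV))" (is "map_pmf ?G D = pmf_of_set ?S")
proof (rule pmf_eqI)
  fix F
  have fin: "finite ?S" by (intro finite_PiE) auto
  have ne: "?S \<noteq> {}" by (auto simp: PiE_eq_empty_iff)
  have lhs: "pmf (map_pmf ?G D) F = measure_pmf.prob D {\<sigma>. ?G \<sigma> = F}"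
    by (simp add: pmf_map vimage_def)
  have G: "?G \<sigma> \<in> ?S" for \<sigma> by auto
  show "pmf (map_pmf ?G D) F = pmf (pmf_of_set ?S) F"
  proof (cases "F \<in> ?S")
    case False
    then have "{\<sigma>. ?G \<sigma> = F} = {}" using G by blast
    then show ?thesis unfolding lhs using False fin ne by simp
  next
    case True
    \<comment> \<open>The flattened form of \<open>F\<close>: output number
      \<open>n = j * k + i\<close> is entry \<open>i\<close> of column \<open>j\<close>, so quotient
      and remainder by \<open>k\<close> recover both indices.\<close>
    define f where "f n = F (n div k) (n mod k)" for n
    have eq: "?G \<sigma> = F \<longleftrightarrow> (\<forall>n\<in>{..<k * l}. prng_seq R \<sigma> n = f n)" for \<sigma>
    proof
      assume F: "?G \<sigma> = F"
      show "\<forall>n\<in>{..<k * l}. prng_seq R \<sigma> n = f n"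
      proof
        fix n assume "n \<in> {..<k * l}"
        then have "n div k < l" "n mod k < k"
          using \<open>k \<ge> 1\<close> by (auto simp: less_mult_imp_div_less mult.commute)
        then show "prng_seq R \<sigma> n = f n"
          unfolding f_def F[symmetric] by simp
      qed
    next
      assume n: "\<forall>n\<in>{..<k * l}. prng_seq R \<sigma> n = f n"
      have "prng_seq R \<sigma> (j * k + i) = F j i" if "j < l" "i < k" for i j
      proof -
        \<comment> \<open>The position lies in block \<open>j\<close>, which ends within the first
          \<open>l\<close> blocks, so the prescribed values in \<open>n\<close> cover it.\<close>
        have "j * k + i < Suc j * k" using that by simp
        also have "\<dots> \<le> l * k" using that by (intro mult_right_mono) auto
        finally show ?thesis using n that by (simp add: f_def mult.commute)
      qed
      then show "?G \<sigma> = F"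
        using True by (intro PiE_ext[OF G True] PiE_ext[where k = "{..<k}" and s = "\<lambda>_. UNIV"])
          (auto simp: PiE_mem)
    qed
    have ind: "prob_space.indep_vars (measure_pmf D) (\<lambda>_. count_space UNIV)
        (\<lambda>i \<sigma>. prng_seq R \<sigma> i) {..<k * l}"
      using iid \<open>N \<ge> k * l\<close> unfolding iid_uniform_output_def
      by (auto intro: prob_space.indep_vars_subset[OF measure_pmf.prob_space_axioms])
    have uni: "measure_pmf.prob D {\<sigma>. prng_seq R \<sigma> n = x} = 1 / CARD('a)" if "n < k * l" for n x
    proof -
      have "measure_pmf.prob D {\<sigma>. prng_seq R \<sigma> n = x} = pmf (map_pmf (\<lambda>\<sigma>. prng_seq R \<sigma> n) D) x"
        by (simp add: pmf_map vimage_def)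
      also have "\<dots> = pmf (pmf_of_set UNIV) x"
        using iid that \<open>N \<ge> k * l\<close> by (simp add: iid_uniform_output_def)
      finally show ?thesis by simp
    qed
    have "pmf (map_pmf ?G D) F = (\<Prod>n<k * l. 1 / real CARD('a))"
      unfolding lhs eq using measure_pmf.indep_vars_prob_eq[OF ind, of f] by (simp add: uni)
    also have "\<dots> = 1 / real (card ?S)"
      by (simp add: card_PiE power_divide power_mult)
    finally show ?thesis using True fin ne by simp
  qed
qed

lemma tag_vec_index:
  assumes "u \<in> carrier_vec k" "j < l"
  shows "Matrix.vec_index (tag_vec R k l \<sigma> u) j
    = (\<Sum>i<k. Matrix.vec_index u i * prng_seq R \<sigma> (j * k + i))"
  using assms by (auto simp: tag_vec_def gen_matrix_def scalar_prod_def atLeast0LessThan)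

text \<open>The tag is linear in the message, so comparing two tags reduces to one homogeneous
  equation for each column, all with the same coefficients.\<close>

lemma tag_vec_eq_iff:
  fixes R :: "'a::comm_ring prng"
  assumes "u \<in> carrier_vec k" "u' \<in> carrier_vec k"
  shows "tag_vec R k l \<sigma> u' = tag_vec R k l \<sigma> u \<longleftrightarrow>
    (\<forall>j<l. (\<Sum>i<k. (Matrix.vec_index u' i - Matrix.vec_index u i) * prng_seq R \<sigma> (j * k + i)) = 0)"
proof -
  have "dim_vec (tag_vec R k l \<sigma> v) = l" for v
    by (simp add: tag_vec_def gen_matrix_def)
  then have "tag_vec R k l \<sigma> u' = tag_vec R k l \<sigma> u \<longleftrightarrow>
      (\<forall>j<l. Matrix.vec_index (tag_vec R k l \<sigma> u') j = Matrix.vec_index (tag_vec R k l \<sigma> u) j)"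
    by (auto intro: eq_vecI)
  then show ?thesis
    using assms by (simp add: tag_vec_index left_diff_distrib sum_subtractf)
qed

lemma P2_eq:
  fixes R :: "'a::{field, finite} prng"
  assumes "iid_uniform_output R D N" "N \<ge> k * l" "k \<ge> 1"
    and u: "u \<in> carrier_vec k" and u': "u' \<in> carrier_vec k" and "u \<noteq> u'"
  shows "P2 R k l D u u' = real CARD('a) powi (- int l)"
proof -
  define d where "d i = Matrix.vec_index u' i - Matrix.vec_index u i" for i
  \<comment> \<open>Distinct messages differ in some coordinate, which supplies the nonzero
    coefficient for \<open>card_PiE_hyperplane\<close>.\<close>
  have "\<exists>i0<k. d i0 \<noteq> 0"
  proof (rule ccontr)
    assume "\<not> ?thesis"
    then have "u = u'" using u u' by (intro eq_vecI) (auto simp: d_def)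
    then show False using \<open>u \<noteq> u'\<close> by simp
  qed
  then obtain i0 where i0: "i0 < k" "d i0 \<noteq> 0" by blast
  let ?G = "\<lambda>\<sigma>. \<lambda>j\<in>{..<l}. \<lambda>i\<in>{..<k}. prng_seq R \<sigma> (j * k + i)"
  let ?S = "{..<l} \<rightarrow>\<^sub>E ({..<k} \<rightarrow>\<^sub>E (UNIV :: 'a set))"
  let ?H = "{g \<in> {..<k} \<rightarrow>\<^sub>E UNIV. (\<Sum>i<k. d i * g i) = 0}"
  have fin: "finite ?S" by (intro finite_PiE) auto
  have ne: "?S \<noteq> {}" by (auto simp: PiE_eq_empty_iff)
  \<comment> \<open>Each equation involves only its own column, so false acceptance is the preimage
    of a product of \<open>l\<close> copies of the hyperplane \<open>?H\<close>.\<close>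
  have "P2 R k l D u u' = measure_pmf.prob D (?G -` ({..<l} \<rightarrow>\<^sub>E ?H))"
    unfolding P2_def accepts_def id_word_def
    by (simp add: tag_vec_eq_iff[OF u u'] d_def[symmetric] vimage_def PiE_iff Ball_def)
  \<comment> \<open>Pushing \<open>D\<close> forward along \<open>?G\<close> leaves a pure counting
    problem.\<close>
  also have "\<dots> = measure_pmf.prob (pmf_of_set ?S) ({..<l} \<rightarrow>\<^sub>E ?H)"
    by (simp flip: column_segments_uniform[OF assms(1-3)])
  also have "\<dots> = real (card (?S \<inter> ({..<l} \<rightarrow>\<^sub>E ?H))) / real (card ?S)"
    using fin ne by (simp add: measure_pmf_of_set)
  also have "?S \<inter> ({..<l} \<rightarrow>\<^sub>E ?H) = {..<l} \<rightarrow>\<^sub>E ?H"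
    by (intro Int_absorb1 PiE_mono) blast
  also have "real (card ({..<l} \<rightarrow>\<^sub>E ?H)) / real (card ?S)
      = (real CARD('a) ^ (k - 1) / real CARD('a) ^ k) ^ l"
    using i0 by (simp add: card_PiE card_PiE_hyperplane power_divide)
  \<comment> \<open>Subtraction on naturals is truncated; \<open>k \<ge> 1\<close> makes the
    exponents differ by exactly one.\<close>
  also have "real CARD('a) ^ (k - 1) / real CARD('a) ^ k = inverse (real CARD('a))"
    using \<open>k \<ge> 1\<close> by (cases k) (auto simp: field_simps)
  finally show ?thesis
    by (simp add: power_int_minus power_inverse)
qed

theorem theorem3:
  fixes R :: "'a::{field, finite} prng"
    and D :: "'a Matrix.vec pmf"
    and q k l \<mu> N :: nat
  assumes "primepow q" and "CARD('a) = q"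
    and "k \<ge> 1" and "l \<ge> 1" and "\<mu> \<ge> 1"
    and "prng_with_memory \<mu> R"
    and "set_pmf D \<subseteq> carrier_vec \<mu>"
    and "N \<ge> k * l"
    and "iid_uniform_output R D N"
  shows "(\<forall>u\<in>carrier_vec k. \<forall>u'\<in>carrier_vec k. u \<noteq> u' \<longrightarrow>
            P2 R k l D u u' = real q powi (- int l))
       \<and> lambda2 R k l D = real q powi (- int l)"
proof -
  have P2: "P2 R k l D u u' = real q powi (- int l)"
    if "u \<in> carrier_vec k" "u' \<in> carrier_vec k" "u \<noteq> u'" for u u'
    using P2_eq[OF assms(9,8,3) that] assms(2) by simp
  \<comment> \<open>Two distinct messages are exhibited, so the set whose maximum defines
    \<open>lambda2\<close> is nonempty and thus a singleton. Index 0 is in range because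
    \<open>k \<ge> 1\<close>.\<close>
  have "Matrix.vec_index (0\<^sub>v k :: 'a Matrix.vec) 0 \<noteq> Matrix.vec_index (unit_vec k 0) 0"
    using assms(3) by simp
  then have "0\<^sub>v k \<noteq> (unit_vec k 0 :: 'a Matrix.vec)" by metis
  then have "\<exists>u u' :: 'a Matrix.vec. u \<in> carrier_vec k \<and> u' \<in> carrier_vec k \<and> u \<noteq> u'"
    using zero_carrier_vec unit_vec_carrier by blast
  then have "{P2 R k l D u u' | u u'. u \<in> carrier_vec k \<and> u' \<in> carrier_vec k \<and> u \<noteq> u'}
      = {real q powi (- int l)}"
    using P2 by (auto; metis)
  then show ?thesis
    using P2 by (simp add: lambda2_def)
qed

end
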